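(* Let $\Phi$ be a finite irreducible crystallographic root system with simple system $\Pi$, let $S\subseteq\Pi$ and $\beta\in\Phi^+$ with $\mathrm{Supp}(\beta)\cap S\neq\emptyset$. Then: (1) $\max\Phi_{S,\beta}$ and $-\min\Phi_{S,\beta}$ are both $(\Pi\setminus S)$-dominant; (2) if $\Phi_{S,\beta}$ contains some long roots, then $\max\Phi_{S,\beta}$ is the unique long $(\Pi\setminus S)$-dominant root in $\Phi_{S,\beta}$; otherwise, $\max\Phi_{S,\beta}$ is the unique (short) $(\Pi\setminus S)$-dominant root in $\Phi_{S,\beta}$.
   Context: $\Phi$ is reduced, in a Euclidean space $\mathbb E=\mathrm{Span}_{\mathbb R}\Phi$ with Weyl-group-invariant form $(\cdot,\cdot)$; $\Phi^+$ is the set of positive roots with respect to $\Pi$. Each root $\gamma$ is written $\gamma=\sum_{\alpha\in\Pi}c_\alpha(\gamma)\alpha$; $\mathrm{Supp}(\gamma)=\{\alpha\in\Pi:c_\alpha(\gamma)\ne0\}$. Define $\Phi_{S,\beta}=\{\gamma\in\Phi:c_\alpha(\gamma)=c_\alpha(\beta)\ \forall\alpha\in S\}$. When $\beta\in\Phi^+$ and $\mathrm{Supp}(\beta)\cap S\ne\emptyset$, this set is known to have a minimum and a maximum in the root poset ($\Phi^+$ ordered by $\alpha\le\beta$ iff $\beta-\alpha$ is a nonnegative linear combination of positive roots). For $T\subseteq\Pi$, $v\in\mathbb E$ is $T$-dominant if $(v,\alpha)\ge0$ for all $\alpha\in T$. In simply laced root systems all roots are considered long. *)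

theory Defs
  imports "HOL-Analysis.Analysis"
begin

text \<open>The ambient type plays the role of the Euclidean space \<open>\<bbbE>\<close>, with \<open>\<bullet>\<close> as the form.
  Since the reflections below are defined through \<open>\<bullet>\<close>, they are isometries, so \<open>\<bullet>\<close> is
  automatically invariant under the Weyl group they generate.\<close>

definition reflection :: "'a::euclidean_space \<Rightarrow> 'a \<Rightarrow> 'a" where
  "reflection \<alpha> v = v - (2 * (v \<bullet> \<alpha>) / (\<alpha> \<bullet> \<alpha>)) *\<^sub>R \<alpha>"

locale root_system =
  fixes \<Phi> :: "'a::euclidean_space set"
  assumes finite_roots: "finite \<Phi>"
    and zero_not_root: "0 \<notin> \<Phi>"
    and span_roots: "span \<Phi> = UNIV"
    and reflection_root: "\<alpha> \<in> \<Phi> \<Longrightarrow> \<gamma> \<in> \<Phi> \<Longrightarrow> reflection \<alpha> \<gamma> \<in> \<Phi>"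
    and crystallographic: "\<alpha> \<in> \<Phi> \<Longrightarrow> \<gamma> \<in> \<Phi> \<Longrightarrow> 2 * (\<gamma> \<bullet> \<alpha>) / (\<alpha> \<bullet> \<alpha>) \<in> \<int>"
    and reduced: "\<alpha> \<in> \<Phi> \<Longrightarrow> c *\<^sub>R \<alpha> \<in> \<Phi> \<Longrightarrow> c = 1 \<or> c = -1"

locale irreducible_root_system = root_system +
  assumes nonempty: "\<Phi> \<noteq> {}"
    and irreducible:
      "\<Phi> = A \<union> B \<Longrightarrow> A \<inter> B = {} \<Longrightarrow> (\<And>a b. a \<in> A \<Longrightarrow> b \<in> B \<Longrightarrow> a \<bullet> b = 0) \<Longrightarrow> A = {} \<or> B = {}"

text \<open>\<open>representation \<Delta> \<gamma> \<alpha>\<close> is the coefficient \<open>c\<^sub>\<alpha>(\<gamma>)\<close>. It is only meaningful for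
  \<open>\<gamma> \<in> span \<Delta>\<close>, which is the whole space when \<open>\<Delta>\<close> is a simple system.\<close>

definition simple_system :: "'a::euclidean_space set \<Rightarrow> 'a set \<Rightarrow> bool" where
  "simple_system \<Phi> \<Delta> \<longleftrightarrow>
     \<Delta> \<subseteq> \<Phi> \<and> independent \<Delta> \<and> span \<Delta> = span \<Phi> \<and>
     (\<forall>\<gamma>\<in>\<Phi>. (\<forall>\<alpha>\<in>\<Delta>. representation \<Delta> \<gamma> \<alpha> \<ge> 0) \<or> (\<forall>\<alpha>\<in>\<Delta>. representation \<Delta> \<gamma> \<alpha> \<le> 0))"

definition positive_roots :: "'a::euclidean_space set \<Rightarrow> 'a set \<Rightarrow> 'a set" where
  "positive_roots \<Phi> \<Delta> = {\<gamma> \<in> \<Phi>. \<forall>\<alpha>\<in>\<Delta>. representation \<Delta> \<gamma> \<alpha> \<ge> 0}"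

definition Supp :: "'a::euclidean_space set \<Rightarrow> 'a \<Rightarrow> 'a set" where
  "Supp \<Delta> \<gamma> = {\<alpha> \<in> \<Delta>. representation \<Delta> \<gamma> \<alpha> \<noteq> 0}"

definition root_fiber :: "'a::euclidean_space set \<Rightarrow> 'a set \<Rightarrow> 'a set \<Rightarrow> 'a \<Rightarrow> 'a set" where
  "root_fiber \<Phi> \<Delta> S \<beta> = {\<gamma> \<in> \<Phi>. \<forall>\<alpha>\<in>S. representation \<Delta> \<gamma> \<alpha> = representation \<Delta> \<beta> \<alpha>}"

definition root_le :: "'a::euclidean_space set \<Rightarrow> 'a set \<Rightarrow> 'a \<Rightarrow> 'a \<Rightarrow> bool" where
  "root_le \<Phi> \<Delta> \<gamma> \<delta> \<longleftrightarrow>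
     \<gamma> \<in> positive_roots \<Phi> \<Delta> \<and> \<delta> \<in> positive_roots \<Phi> \<Delta> \<and>
     (\<exists>c :: 'a \<Rightarrow> real. (\<forall>\<epsilon>\<in>positive_roots \<Phi> \<Delta>. c \<epsilon> \<ge> 0) \<and>
        \<delta> - \<gamma> = (\<Sum>\<epsilon>\<in>positive_roots \<Phi> \<Delta>. c \<epsilon> *\<^sub>R \<epsilon>))"

text \<open>Maximum and minimum in the root poset, as greatest and least elements.\<close>

definition root_max :: "'a::euclidean_space set \<Rightarrow> 'a set \<Rightarrow> 'a set \<Rightarrow> 'a" where
  "root_max \<Phi> \<Delta> A = (THE m. m \<in> A \<and> (\<forall>\<gamma>\<in>A. root_le \<Phi> \<Delta> \<gamma> m))"

definition root_min :: "'a::euclidean_space set \<Rightarrow> 'a set \<Rightarrow> 'a set \<Rightarrow> 'a" where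
  "root_min \<Phi> \<Delta> A = (THE m. m \<in> A \<and> (\<forall>\<gamma>\<in>A. root_le \<Phi> \<Delta> m \<gamma>))"

definition dominant :: "'a::euclidean_space set \<Rightarrow> 'a \<Rightarrow> bool" where
  "dominant T v \<longleftrightarrow> (\<forall>\<alpha>\<in>T. v \<bullet> \<alpha> \<ge> 0)"

text \<open>An irreducible root system has at most two root lengths. If there is only one (the simply
  laced case), every root is long under this definition and none is short.\<close>

definition long_root :: "'a::euclidean_space set \<Rightarrow> 'a \<Rightarrow> bool" where
  "long_root \<Phi> \<gamma> \<longleftrightarrow> \<gamma> \<in> \<Phi> \<and> (\<forall>\<delta>\<in>\<Phi>. norm \<delta> \<le> norm \<gamma>)"

definition short_root :: "'a::euclidean_space set \<Rightarrow> 'a \<Rightarrow> bool" where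
  "short_root \<Phi> \<gamma> \<longleftrightarrow> \<gamma> \<in> \<Phi> \<and> \<not> long_root \<Phi> \<gamma>"

end

theory Submission
  imports Defs
begin

text \<open>Write \<open>T = \<Delta> - S\<close>. A root that is maximal in its length class within the fiber is \<open>T\<close>-dominant,
  since otherwise a simple reflection raises it. Any two \<open>T\<close>-dominant roots of the fiber differ by an
  element of \<open>span T\<close>, so they share a nonzero component orthogonal to \<open>span T\<close>; their
  components in \<open>span T\<close> are dominant there, hence have nonnegative inner product. Thus two distinct
  \<open>T\<close>-dominant roots have positive inner product, their difference is a root, and by
  dominance the larger one is strictly longer. This yields the maximum of the fiber, the minimum
  (via \<open>-\<beta>\<close>), and uniqueness within a given length. If no root of the fiber is long,
  uniqueness follows because an irreducible root system has at most two root lengths.\<close>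

section \<open>Euclidean preliminaries: reflections and obtuse bases\<close>

lemma reflection_inner_self:
  assumes "\<alpha> \<noteq> 0"
  shows "reflection \<alpha> v \<bullet> reflection \<alpha> v = v \<bullet> v"
  using assms by (simp add: reflection_def inner_diff inner_commute field_simps)

lemma norm_reflection:
  assumes "\<alpha> \<noteq> 0"
  shows "norm (reflection \<alpha> v) = norm v"
  by (simp add: norm_eq_sqrt_inner reflection_inner_self[OF assms])

text \<open>Split \<open>x\<close> as \<open>p - n\<close> by the signs of its coefficients.
  Dominance gives \<open>x \<bullet> n \<ge> 0\<close> and obtuseness gives
  \<open>p \<bullet> n \<le> 0\<close>, which together force \<open>n = 0\<close>. So
  \<open>x\<close> is a nonnegative combination of \<open>T\<close>, and such a vector pairs
  nonnegatively with the dominant \<open>y\<close>.\<close>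

lemma acute_obtuse_basis:
  fixes T :: "'a::euclidean_space set"
  assumes fin: "finite T" and indep: "independent T"
    and obtuse: "\<And>a b. a \<in> T \<Longrightarrow> b \<in> T \<Longrightarrow> a \<noteq> b \<Longrightarrow> a \<bullet> b \<le> 0"
    and x: "x \<in> span T" "dominant T x" and y: "dominant T y"
  shows "x \<bullet> y \<ge> 0"
proof -
  obtain c where c: "x = (\<Sum>a\<in>T. c a *\<^sub>R a)"
    using x(1) span_finite[OF fin] by auto
  define p where "p = (\<Sum>a\<in>T. max (c a) 0 *\<^sub>R a)"
  define n where "n = (\<Sum>a\<in>T. max (- c a) 0 *\<^sub>R a)"
  have xpn: "x = p - n"
    unfolding c p_def n_def sum_subtractf[symmetric] scaleR_diff_left[symmetric]
    by (intro sum.cong refl arg_cong2[where f = scaleR]) auto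
  have "x \<bullet> n \<ge> 0"
    using x(2) by (auto simp: n_def inner_sum_right dominant_def intro!: sum_nonneg)
  moreover have "p \<bullet> n \<le> 0"
  proof -
    \<comment> \<open>The diagonal terms vanish because no coefficient is both positive and
      negative.\<close>
    have "(max (c a) 0 *\<^sub>R a) \<bullet> (max (- c b) 0 *\<^sub>R b) \<le> 0" if "a \<in> T" "b \<in> T" for a b
    proof (cases "a = b")
      case True
      then show ?thesis by (auto simp: max_def)
    next
      case False
      then have "max (c a) 0 * (max (- c b) 0 * (a \<bullet> b)) \<le> 0"
        using obtuse[OF that] by (intro mult_nonneg_nonpos) auto
      then show ?thesis by (simp add: mult_ac)
    qed
    then show ?thesis
      unfolding p_def n_def inner_sum_left inner_sum_right by (intro sum_nonpos) blast
  qed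
  ultimately have "n \<bullet> n \<le> 0"
    by (simp add: xpn inner_diff_left)
  then have "n = 0"
    by (metis inner_eq_zero_iff inner_ge_zero order_antisym)
  then have "x = p"
    using xpn by simp
  show ?thesis
    using y unfolding \<open>x = p\<close> p_def inner_sum_left
    by (intro sum_nonneg) (auto simp: dominant_def inner_commute)
qed

section \<open>Pairs of roots at an acute angle\<close>

context root_system
begin

lemma uminus_root:
  assumes "\<gamma> \<in> \<Phi>"
  shows "- \<gamma> \<in> \<Phi>"
proof -
  have "reflection \<gamma> \<gamma> = - \<gamma>"
    using assms zero_not_root by (auto simp: reflection_def scaleR_2)
  then show ?thesis
    using reflection_root[OF assms assms] by simp
qed

text \<open>Both Cartan integers of the pair are positive, and their product is 4 cos^2 of the
  angle, which is below 4 because the roots are not parallel. So one of them is 1 and the other is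
  at most 3; the latter is the ratio \<open>m\<close> of squared lengths.\<close>

lemma cartan_cases:
  assumes "\<gamma> \<in> \<Phi>" "\<delta> \<in> \<Phi>" "\<gamma> \<bullet> \<delta> > 0" "\<gamma> \<noteq> \<delta>"
  obtains m where "m \<in> {1, 2, 3::real}" "2 * (\<gamma> \<bullet> \<delta>) = \<delta> \<bullet> \<delta>" "\<delta> \<bullet> \<delta> = m * (\<gamma> \<bullet> \<gamma>)"
  | m where "m \<in> {1, 2, 3::real}" "2 * (\<gamma> \<bullet> \<delta>) = \<gamma> \<bullet> \<gamma>" "\<gamma> \<bullet> \<gamma> = m * (\<delta> \<bullet> \<delta>)"
proof -
  have nz: "\<gamma> \<noteq> 0" "\<delta> \<noteq> 0"
    using assms zero_not_root by auto
  then have pos: "\<gamma> \<bullet> \<gamma> > 0" "\<delta> \<bullet> \<delta> > 0"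
    by auto
  obtain p q :: int where pq: "2 * (\<gamma> \<bullet> \<delta>) / (\<delta> \<bullet> \<delta>) = p" "2 * (\<gamma> \<bullet> \<delta>) / (\<gamma> \<bullet> \<gamma>) = q"
    using crystallographic[of \<delta> \<gamma>] crystallographic[of \<gamma> \<delta>] assms
    by (metis Ints_cases inner_commute)
  then have eq: "2 * (\<gamma> \<bullet> \<delta>) = p * (\<delta> \<bullet> \<delta>)" "2 * (\<gamma> \<bullet> \<delta>) = q * (\<gamma> \<bullet> \<gamma>)"
    using pos by (auto simp: field_simps)
  have "p > 0" "q > 0"
    using pq pos assms(3) by (metis divide_pos_pos mult_pos_pos of_int_0_less_iff zero_less_numeral)+
  \<comment> \<open>Equality in Cauchy-Schwarz would make \<delta> a positive multiple of \<gamma>,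
    hence \<gamma> itself in a reduced system.\<close>
  have strict: "(\<gamma> \<bullet> \<delta>)\<^sup>2 < (\<gamma> \<bullet> \<gamma>) * (\<delta> \<bullet> \<delta>)"
  proof (rule ccontr)
    assume "\<not> ?thesis"
    then have "(\<gamma> \<bullet> \<delta>)\<^sup>2 = (\<gamma> \<bullet> \<gamma>) * (\<delta> \<bullet> \<delta>)"
      using Cauchy_Schwarz_ineq[of \<gamma> \<delta>] by simp
    then have "\<bar>\<gamma> \<bullet> \<delta>\<bar> = norm \<gamma> * norm \<delta>"
      by (metis norm_eq_sqrt_inner real_sqrt_abs real_sqrt_mult)
    then have "norm \<gamma> *\<^sub>R \<delta> = norm \<delta> *\<^sub>R \<gamma>"
      using assms(3) norm_cauchy_schwarz_eq[of \<gamma> \<delta>] by simp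
    then have \<delta>: "\<delta> = (norm \<delta> / norm \<gamma>) *\<^sub>R \<gamma>"
      using nz by (metis divideR_right norm_eq_zero scaleR_scaleR divide_inverse_commute)
    moreover have "norm \<delta> / norm \<gamma> > 0"
      using nz by simp
    ultimately have "norm \<delta> / norm \<gamma> = 1"
      using reduced[of \<gamma> "norm \<delta> / norm \<gamma>"] assms by auto
    then show False
      using \<delta> assms(4) by (metis scaleR_one)
  qed
  have "real_of_int (p * q) * ((\<gamma> \<bullet> \<gamma>) * (\<delta> \<bullet> \<delta>)) = 4 * (\<gamma> \<bullet> \<delta>)\<^sup>2"
    using arg_cong2[OF eq, of "(*)"] by (simp add: power2_eq_square mult_ac)
  also have "\<dots> < 4 * ((\<gamma> \<bullet> \<gamma>) * (\<delta> \<bullet> \<delta>))"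
    using strict by simp
  finally have pq4: "p * q < 4"
    using pos by (simp only: mult_less_cancel_right_pos mult_pos_pos)
  have "p = 1 \<or> q = 1"
  proof (rule ccontr)
    assume "\<not> ?thesis"
    then have "2 * 2 \<le> p * q"
      using \<open>p > 0\<close> \<open>q > 0\<close> by (intro mult_mono) auto
    then show False
      using pq4 by simp
  qed
  then show thesis
  proof
    assume "p = 1"
    then have "q \<in> {1, 2, 3}"
      using pq4 \<open>q > 0\<close> by auto
    then show thesis
      using eq \<open>p = 1\<close> by (intro that(1)[of q]) auto
  next
    assume "q = 1"
    then have "p \<in> {1, 2, 3}"
      using pq4 \<open>p > 0\<close> by auto
    then show thesis
      using eq \<open>q = 1\<close> by (intro that(2)[of p]) auto
  qed
qed

text \<open>One of the two Cartan integers is 1, so reflecting one root in the other subtracts it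
  exactly once; this yields the difference up to sign.\<close>

lemma diff_root:
  assumes "\<gamma> \<in> \<Phi>" "\<delta> \<in> \<Phi>" "\<gamma> \<bullet> \<delta> > 0" "\<gamma> \<noteq> \<delta>"
  shows "\<gamma> - \<delta> \<in> \<Phi>"
  using assms
proof (cases rule: cartan_cases)
  case (1 m)
  then have "reflection \<delta> \<gamma> = \<gamma> - \<delta>"
    using assms zero_not_root by (auto simp: reflection_def)
  then show ?thesis
    using reflection_root assms by metis
next
  case (2 m)
  then have "reflection \<gamma> \<delta> = \<delta> - \<gamma>"
    using assms zero_not_root by (auto simp: reflection_def inner_commute)
  then show ?thesis
    using reflection_root[of \<gamma> \<delta>] uminus_root[of "\<delta> - \<gamma>"] assms by simp
qed

end

section \<open>Root lengths in an irreducible root system\<close>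

context irreducible_root_system
begin

text \<open>The roots of a given length are permuted by all reflections, so they can replace a Weyl group
  orbit in the usual argument.\<close>

lemma exists_nonorthogonal_same_norm:
  assumes "\<alpha> \<in> \<Phi>" "\<beta> \<in> \<Phi>"
  shows "\<exists>\<gamma>\<in>\<Phi>. norm \<gamma> = norm \<alpha> \<and> \<gamma> \<bullet> \<beta> \<noteq> 0"
proof -
  define A where "A = {\<delta> \<in> \<Phi>. \<exists>\<gamma>\<in>\<Phi>. norm \<gamma> = norm \<alpha> \<and> \<gamma> \<bullet> \<delta> \<noteq> 0}"
  \<comment> \<open>A witness \<gamma> for \<open>a\<close> and its reflection in \<open>a\<close>
    have the same length, so both are orthogonal to \<open>b\<close>, which lies outside
    \<open>A\<close>. Their difference is a nonzero multiple of \<open>a\<close>.\<close>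
  have "a \<bullet> b = 0" if a: "a \<in> A" and b: "b \<in> \<Phi> - A" for a b
  proof -
    obtain \<gamma> where \<gamma>: "a \<in> \<Phi>" "\<gamma> \<in> \<Phi>" "norm \<gamma> = norm \<alpha>" "\<gamma> \<bullet> a \<noteq> 0"
      using a by (auto simp: A_def)
    have "a \<noteq> 0"
      using \<gamma> by auto
    have "\<gamma> \<bullet> b = 0" "reflection a \<gamma> \<bullet> b = 0"
      using b \<gamma> reflection_root norm_reflection[OF \<open>a \<noteq> 0\<close>, of \<gamma>] by (auto simp: A_def)
    then show ?thesis
      using \<gamma> \<open>a \<noteq> 0\<close> by (simp add: reflection_def inner_diff_left)
  qed
  then have "A = {} \<or> \<Phi> - A = {}"
    by (intro irreducible) (auto simp: A_def)
  moreover have "\<alpha> \<in> A"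
    using assms zero_not_root by (auto simp: A_def intro!: bexI[of _ \<alpha>])
  ultimately have "\<beta> \<in> A"
    using assms by blast
  then show ?thesis
    by (auto simp: A_def)
qed

text \<open>Trading \<alpha> for a root of the same length that is not orthogonal to \<beta>, with
  its sign changed if needed, brings the pair into the scope of \<open>cartan_cases\<close>. The
  strict length inequality excludes the ratio 1 and the reversed case.\<close>

lemma norm_ratio:
  assumes "\<alpha> \<in> \<Phi>" "\<beta> \<in> \<Phi>" "norm \<alpha> < norm \<beta>"
  shows "(norm \<beta>)\<^sup>2 = 2 * (norm \<alpha>)\<^sup>2 \<or> (norm \<beta>)\<^sup>2 = 3 * (norm \<alpha>)\<^sup>2"
proof -
  obtain \<gamma> where "\<gamma> \<in> \<Phi>" "norm \<gamma> = norm \<alpha>" "\<gamma> \<bullet> \<beta> \<noteq> 0"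
    using exists_nonorthogonal_same_norm assms by blast
  then obtain \<gamma> where \<gamma>: "\<gamma> \<in> \<Phi>" "norm \<gamma> = norm \<alpha>" "\<gamma> \<bullet> \<beta> > 0"
    using uminus_root[of \<gamma>] by (cases "\<gamma> \<bullet> \<beta> > 0") (fastforce dest: spec[of _ "- \<gamma>"])+
  have lt: "(norm \<gamma>)\<^sup>2 < (norm \<beta>)\<^sup>2" "(norm \<gamma>)\<^sup>2 \<ge> 0"
    using \<gamma> assms by (auto intro!: power_strict_mono)
  have "\<gamma> \<noteq> \<beta>"
    using lt by auto
  from \<gamma>(1) assms(2) \<gamma>(3) this show ?thesis
  proof (cases rule: cartan_cases)
    case (1 m)
    then show ?thesis
      using lt \<gamma>(2) by (auto simp flip: power2_norm_eq_inner)
  next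
    case (2 m)
    then show ?thesis
      using lt \<gamma>(2) by (auto simp flip: power2_norm_eq_inner)
  qed
qed

text \<open>Two successive ratios of squared lengths, each 2 or 3, multiply to 4, 6 or 9, and none
  of these is an allowed ratio for the outer pair.\<close>

lemma no_three_norms:
  assumes "\<alpha> \<in> \<Phi>" "\<beta> \<in> \<Phi>" "\<gamma> \<in> \<Phi>" "norm \<alpha> < norm \<beta>" "norm \<beta> < norm \<gamma>"
  shows False
proof -
  have "(norm \<alpha>)\<^sup>2 > 0"
    using assms zero_not_root by auto
  then show False
    using norm_ratio[of \<alpha> \<beta>] norm_ratio[of \<beta> \<gamma>] norm_ratio[of \<alpha> \<gamma>] assms by linarith
qed

end

section \<open>Simple systems and the coefficientwise order\<close>

locale based_root_system = root_system \<Phi>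
  for \<Phi> :: "'a::euclidean_space set" +
  fixes \<Delta> :: "'a set"
  assumes simple: "simple_system \<Phi> \<Delta>"
begin

abbreviation coef :: "'a \<Rightarrow> 'a \<Rightarrow> real" where
  "coef \<equiv> representation \<Delta>"

text \<open>Agrees with \<open>root_le\<close> on positive roots but also compares negative ones, so
  that negation can later turn greatest elements into least ones.\<close>

definition coef_le :: "'a \<Rightarrow> 'a \<Rightarrow> bool" where
  "coef_le \<gamma> \<delta> \<longleftrightarrow> (\<forall>\<alpha>\<in>\<Delta>. coef \<gamma> \<alpha> \<le> coef \<delta> \<alpha>)"

lemma simple_root: "\<alpha> \<in> \<Delta> \<Longrightarrow> \<alpha> \<in> \<Phi>"
  and independent_simple: "independent \<Delta>"
  and span_simple: "span \<Delta> = UNIV"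
  and coef_signs: "\<gamma> \<in> \<Phi> \<Longrightarrow> (\<forall>\<alpha>\<in>\<Delta>. coef \<gamma> \<alpha> \<ge> 0) \<or> (\<forall>\<alpha>\<in>\<Delta>. coef \<gamma> \<alpha> \<le> 0)"
  using simple span_roots by (auto simp: simple_system_def)

lemma finite_simple: "finite \<Delta>"
  using independent_simple by (rule independent_imp_finite)

lemma in_span_simple [simp]: "v \<in> span \<Delta>"
  by (simp add: span_simple)

lemma coef_diff: "coef (u - v) \<alpha> = coef u \<alpha> - coef v \<alpha>"
  and coef_uminus: "coef (- v) \<alpha> = - coef v \<alpha>"
  and coef_scaleR: "coef (r *\<^sub>R v) \<alpha> = r * coef v \<alpha>"
  and coef_sum: "coef (sum f I) \<alpha> = (\<Sum>i\<in>I. coef (f i) \<alpha>)"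
  by (simp_all add: representation_diff[OF independent_simple] representation_neg[OF independent_simple]
      representation_scale[OF independent_simple] representation_sum[OF independent_simple])

lemma coef_simple: "\<alpha> \<in> \<Delta> \<Longrightarrow> coef \<alpha> \<beta> = (if \<beta> = \<alpha> then 1 else 0)"
  by (rule representation_basis[OF independent_simple, THEN fun_cong, of \<alpha> \<beta>])

lemma sum_coef: "(\<Sum>\<alpha>\<in>\<Delta>. coef v \<alpha> *\<^sub>R \<alpha>) = v"
  by (rule sum_representation_eq[OF independent_simple]) (auto simp: finite_simple)

lemma coef_le_antisym:
  assumes "coef_le \<gamma> \<delta>" "coef_le \<delta> \<gamma>"
  shows "\<gamma> = \<delta>"
proof -
  have "(\<Sum>\<alpha>\<in>\<Delta>. coef \<gamma> \<alpha> *\<^sub>R \<alpha>) = (\<Sum>\<alpha>\<in>\<Delta>. coef \<delta> \<alpha> *\<^sub>R \<alpha>)"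
    using assms by (intro sum.cong refl) (force simp: coef_le_def intro: antisym)
  then show ?thesis
    by (simp add: sum_coef)
qed

lemma coef_le_refl: "coef_le \<gamma> \<gamma>"
  and coef_le_trans: "coef_le \<gamma> \<delta> \<Longrightarrow> coef_le \<delta> \<epsilon> \<Longrightarrow> coef_le \<gamma> \<epsilon>"
  by (force simp: coef_le_def)+

text \<open>Positive roots have nonnegative coordinates and simple roots are positive, so both span
  the same cone.\<close>

lemma root_le_iff_coef_le:
  assumes "\<gamma> \<in> positive_roots \<Phi> \<Delta>" "\<delta> \<in> positive_roots \<Phi> \<Delta>"
  shows "root_le \<Phi> \<Delta> \<gamma> \<delta> \<longleftrightarrow> coef_le \<gamma> \<delta>"
proof
  assume "root_le \<Phi> \<Delta> \<gamma> \<delta>"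
  then obtain c where c: "\<forall>\<epsilon>\<in>positive_roots \<Phi> \<Delta>. c \<epsilon> \<ge> 0"
    "\<delta> - \<gamma> = (\<Sum>\<epsilon>\<in>positive_roots \<Phi> \<Delta>. c \<epsilon> *\<^sub>R \<epsilon>)"
    by (auto simp: root_le_def)
  have "coef (\<delta> - \<gamma>) \<alpha> \<ge> 0" if "\<alpha> \<in> \<Delta>" for \<alpha>
    unfolding c(2) coef_sum coef_scaleR using c(1) that
    by (auto simp: positive_roots_def intro!: sum_nonneg)
  then show "coef_le \<gamma> \<delta>"
    by (simp add: coef_le_def coef_diff)
next
  assume le: "coef_le \<gamma> \<delta>"
  have sub: "\<Delta> \<subseteq> positive_roots \<Phi> \<Delta>"
    using simple_root by (auto simp: positive_roots_def coef_simple)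
  define c where "c \<epsilon> = (if \<epsilon> \<in> \<Delta> then coef (\<delta> - \<gamma>) \<epsilon> else 0)" for \<epsilon>
  have "\<delta> - \<gamma> = (\<Sum>\<epsilon>\<in>\<Delta>. c \<epsilon> *\<^sub>R \<epsilon>)"
    using sum_coef[of "\<delta> - \<gamma>"] by (simp add: c_def)
  also have "\<dots> = (\<Sum>\<epsilon>\<in>positive_roots \<Phi> \<Delta>. c \<epsilon> *\<^sub>R \<epsilon>)"
    using sub finite_roots by (intro sum.mono_neutral_left) (auto simp: c_def positive_roots_def)
  finally have "\<delta> - \<gamma> = \<dots>" .
  moreover have "\<forall>\<epsilon>\<in>positive_roots \<Phi> \<Delta>. c \<epsilon> \<ge> 0"
    using le by (auto simp: c_def coef_le_def coef_diff)
  ultimately show "root_le \<Phi> \<Delta> \<gamma> \<delta>"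
    using assms unfolding root_le_def by blast
qed

text \<open>Otherwise the difference would be a root with coefficients 1 and -1, violating sign
  coherence.\<close>

lemma simple_obtuse:
  assumes "\<alpha> \<in> \<Delta>" "\<beta> \<in> \<Delta>" "\<alpha> \<noteq> \<beta>"
  shows "\<alpha> \<bullet> \<beta> \<le> 0"
proof (rule ccontr)
  assume "\<not> ?thesis"
  then have "\<alpha> - \<beta> \<in> \<Phi>"
    using diff_root assms simple_root by auto
  moreover have "coef (\<alpha> - \<beta>) \<alpha> = 1" "coef (\<alpha> - \<beta>) \<beta> = -1"
    using assms by (auto simp: coef_diff coef_simple)
  ultimately show False
    using coef_signs[of "\<alpha> - \<beta>"] assms by force
qed

end

section \<open>Dominant roots and extremal elements of a fiber\<close>

locale root_fiber_system = based_root_system \<Phi> \<Delta>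
  for \<Phi> \<Delta> :: "'a::euclidean_space set" +
  fixes S :: "'a set" and \<beta> :: 'a
  assumes root: "\<beta> \<in> \<Phi>"
    and Supp_meets: "Supp \<Delta> \<beta> \<inter> S \<noteq> {}"
begin

abbreviation F :: "'a set" where
  "F \<equiv> root_fiber \<Phi> \<Delta> S \<beta>"

lemma finite_fiber: "finite F"
  and self_in_fiber: "\<beta> \<in> F"
  and fiber_root: "\<gamma> \<in> F \<Longrightarrow> \<gamma> \<in> \<Phi>"
  using finite_roots root by (auto simp: root_fiber_def)

lemma reflection_fiber:
  assumes "\<gamma> \<in> F" "\<alpha> \<in> \<Delta> - S"
  shows "reflection \<alpha> \<gamma> \<in> F"
  using assms reflection_root[of \<alpha> \<gamma>] simple_root
  by (auto simp: root_fiber_def reflection_def coef_diff coef_scaleR coef_simple)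

text \<open>Climbing by reflections in \<open>\<Delta> - S\<close> stays in the fiber and preserves
  the norm; keeping the norm is what later lets a long root lead to a long dominant one.\<close>

lemma exists_dominant_above:
  assumes "\<delta> \<in> F"
  obtains \<gamma> where "\<gamma> \<in> F" "norm \<gamma> = norm \<delta>" "coef_le \<delta> \<gamma>" "dominant (\<Delta> - S) \<gamma>"
proof -
  define A where "A = {\<gamma> \<in> F. norm \<gamma> = norm \<delta> \<and> coef_le \<delta> \<gamma>}"
  define height where "height \<gamma> = (\<Sum>\<alpha>\<in>\<Delta>. coef \<gamma> \<alpha>)" for \<gamma>
  have "finite A" "A \<noteq> {}"
    using finite_fiber assms by (auto simp: A_def intro: coef_le_refl)
  then obtain \<gamma> where \<gamma>: "\<gamma> \<in> A" and max: "\<And>\<epsilon>. \<epsilon> \<in> A \<Longrightarrow> height \<epsilon> \<le> height \<gamma>"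
    using obtains_MAX by (metis Max_ge finite_imageI imageI)
  have "\<gamma> \<bullet> \<alpha> \<ge> 0" if \<alpha>: "\<alpha> \<in> \<Delta> - S" for \<alpha>
  proof (rule ccontr)
    assume neg: "\<not> ?thesis"
    then have nz: "\<alpha> \<noteq> 0"
      by auto
    \<comment> \<open>The reflection changes only the \<alpha> coordinate, raising it by
      \<open>k\<close>.\<close>
    define k where "k = - (2 * (\<gamma> \<bullet> \<alpha>) / (\<alpha> \<bullet> \<alpha>))"
    have "k > 0"
      using neg nz by (simp add: k_def divide_neg_pos)
    have coef: "coef (reflection \<alpha> \<gamma>) \<epsilon> = coef \<gamma> \<epsilon> + (if \<epsilon> = \<alpha> then k else 0)" for \<epsilon>
      using \<alpha> by (simp add: reflection_def coef_diff coef_scaleR coef_simple k_def)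
    have "coef_le \<gamma> (reflection \<alpha> \<gamma>)"
      using \<open>k > 0\<close> by (simp add: coef_le_def coef)
    then have "reflection \<alpha> \<gamma> \<in> A"
      using \<gamma> \<alpha> nz reflection_fiber coef_le_trans by (auto simp: A_def norm_reflection)
    moreover have "height (reflection \<alpha> \<gamma>) = height \<gamma> + k"
      using \<alpha> finite_simple by (simp add: height_def coef sum.distrib)
    ultimately show False
      using max[of "reflection \<alpha> \<gamma>"] \<open>k > 0\<close> by simp
  qed
  then show thesis
    using that[of \<gamma>] \<gamma> by (auto simp: A_def dominant_def)
qed

lemma diff_in_span:
  assumes "\<gamma> \<in> F" "\<delta> \<in> F"
  shows "\<gamma> - \<delta> \<in> span (\<Delta> - S)"
proof -
  have "\<gamma> - \<delta> = (\<Sum>\<alpha>\<in>\<Delta>. coef (\<gamma> - \<delta>) \<alpha> *\<^sub>R \<alpha>)"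
    by (simp add: sum_coef)
  also have "\<dots> = (\<Sum>\<alpha>\<in>\<Delta> - S. coef (\<gamma> - \<delta>) \<alpha> *\<^sub>R \<alpha>)"
    using finite_simple assms
    by (intro sum.mono_neutral_right) (auto simp: coef_diff root_fiber_def)
  finally show ?thesis
    by (metis (no_types, lifting) span_base span_scale span_sum)
qed

text \<open>Some coefficient at a simple root in \<open>S\<close> is nonzero, being inherited from
  \<beta>, whereas vectors of the span have no coefficients outside
  \<open>\<Delta> - S\<close>.\<close>

lemma fiber_not_in_span:
  assumes "\<gamma> \<in> F"
  shows "\<gamma> \<notin> span (\<Delta> - S)"
proof
  assume "\<gamma> \<in> span (\<Delta> - S)"
  obtain \<alpha> where \<alpha>: "\<alpha> \<in> S" "coef \<gamma> \<alpha> \<noteq> 0"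
    using Supp_meets assms by (auto simp: Supp_def root_fiber_def)
  have "coef \<gamma> = representation (\<Delta> - S) \<gamma>"
    using representation_extend[OF independent_simple \<open>\<gamma> \<in> span (\<Delta> - S)\<close>] by blast
  then show False
    using \<alpha> representation_ne_zero by fastforce
qed

lemma dominant_inner_pos:
  assumes "\<gamma> \<in> F" "dominant (\<Delta> - S) \<gamma>" "\<delta> \<in> F" "dominant (\<Delta> - S) \<delta>"
  shows "\<gamma> \<bullet> \<delta> > 0"
proof -
  obtain y z where yz: "y \<in> span (\<Delta> - S)" "\<And>w. w \<in> span (\<Delta> - S) \<Longrightarrow> orthogonal z w" "\<gamma> = y + z"
    using orthogonal_subspace_decomp_exists by blast
  \<comment> \<open>\<open>x\<close> is the projection of \<delta> to the span: \<delta> and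
    \<gamma> differ by a vector of the span, so they share the orthogonal component
    \<open>z\<close>.\<close>
  define x where "x = y + (\<delta> - \<gamma>)"
  have x: "x \<in> span (\<Delta> - S)" "\<delta> = x + z"
    using span_add[OF yz(1) diff_in_span[OF assms(3,1)]] yz(3) by (auto simp: x_def)
  have orth: "z \<bullet> w = 0" "w \<bullet> z = 0" if "w \<in> span (\<Delta> - S)" for w
    using yz(2)[OF that] by (auto simp: orthogonal_def inner_commute)
  have "z \<noteq> 0"
    using fiber_not_in_span[OF assms(1)] yz by auto
  have "dominant (\<Delta> - S) y" "dominant (\<Delta> - S) x"
    using assms(2,4) orth yz(3) x(2) by (auto simp: dominant_def inner_add_left span_base)
  then have "y \<bullet> x \<ge> 0"
    using finite_simple independent_mono[OF independent_simple Diff_subset] simple_obtuse yz(1)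
    by (intro acute_obtuse_basis[of "\<Delta> - S"]) auto
  moreover have "\<gamma> \<bullet> \<delta> = y \<bullet> x + z \<bullet> z"
    using yz(1,3) x orth by (simp add: inner_add_left inner_add_right)
  ultimately show ?thesis
    using \<open>z \<noteq> 0\<close> by (simp add: add_nonneg_pos)
qed

text \<open>The difference of two distinct such roots is a root, and the coefficients of a root have
  one sign.\<close>

lemma dominant_coef_le_total:
  assumes "\<gamma> \<in> F" "dominant (\<Delta> - S) \<gamma>" "\<delta> \<in> F" "dominant (\<Delta> - S) \<delta>"
  shows "coef_le \<gamma> \<delta> \<or> coef_le \<delta> \<gamma>"
proof (cases "\<gamma> = \<delta>")
  case False
  then have "\<gamma> - \<delta> \<in> \<Phi>"
    using dominant_inner_pos diff_root fiber_root assms by metis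
  then show ?thesis
    using coef_signs[of "\<gamma> - \<delta>"] by (auto simp: coef_le_def coef_diff)
qed (simp add: coef_le_refl)

text \<open>The increment \<open>r\<close> has no coefficients on \<open>S\<close>, so it is a
  nonnegative combination of \<open>\<Delta> - S\<close>. Dominance of the smaller root alone then
  makes the cross term of the squared norm nonnegative.\<close>

lemma dominant_norm_less:
  assumes "\<gamma> \<in> F" "dominant (\<Delta> - S) \<gamma>" "\<delta> \<in> F" "coef_le \<gamma> \<delta>" "\<gamma> \<noteq> \<delta>"
  shows "norm \<gamma> < norm \<delta>"
proof -
  define r where "r = \<delta> - \<gamma>"
  have "r = (\<Sum>\<alpha>\<in>\<Delta>. coef r \<alpha> *\<^sub>R \<alpha>)"
    by (simp add: sum_coef)
  then have "\<gamma> \<bullet> r = (\<Sum>\<alpha>\<in>\<Delta>. coef r \<alpha> * (\<gamma> \<bullet> \<alpha>))"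
    by (metis (no_types, lifting) inner_scaleR_right inner_sum_right sum.cong)
  also have "\<dots> \<ge> 0"
  proof (intro sum_nonneg)
    fix \<alpha> assume "\<alpha> \<in> \<Delta>"
    then show "coef r \<alpha> * (\<gamma> \<bullet> \<alpha>) \<ge> 0"
      using assms by (cases "\<alpha> \<in> S") (auto simp: r_def coef_diff root_fiber_def coef_le_def dominant_def)
  qed
  finally have "\<gamma> \<bullet> r \<ge> 0" .
  moreover have "r \<bullet> r > 0"
    using assms by (simp add: r_def)
  moreover have "\<delta> \<bullet> \<delta> = \<gamma> \<bullet> \<gamma> + 2 * (\<gamma> \<bullet> r) + r \<bullet> r"
    by (simp add: r_def inner_diff_left inner_diff_right inner_commute)
  ultimately show ?thesis
    unfolding norm_lt by linarith
qed

lemma exists_greatest: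
  obtains m where "m \<in> F" "dominant (\<Delta> - S) m" "\<And>\<gamma>. \<gamma> \<in> F \<Longrightarrow> coef_le \<gamma> m"
proof -
  define D where "D = {\<gamma> \<in> F. dominant (\<Delta> - S) \<gamma>}"
  have "finite D" "D \<noteq> {}"
    using finite_fiber exists_dominant_above[OF self_in_fiber] by (auto simp: D_def)
  then obtain m where m: "m \<in> D" and max: "\<And>\<gamma>. \<gamma> \<in> D \<Longrightarrow> norm \<gamma> \<le> norm m"
    using obtains_MAX by (metis Max_ge finite_imageI imageI)
  have "coef_le \<gamma> m" if "\<gamma> \<in> F" for \<gamma>
  proof -
    obtain \<delta> where \<delta>: "\<delta> \<in> F" "coef_le \<gamma> \<delta>" "dominant (\<Delta> - S) \<delta>"
      using exists_dominant_above[OF \<open>\<gamma> \<in> F\<close>] by metis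
    \<comment> \<open>The two are comparable, and a \<delta> strictly above \<open>m\<close> would
      be longer, against the choice of \<open>m\<close> as a longest dominant root.\<close>
    have "coef_le \<delta> m"
      using dominant_coef_le_total[of \<delta> m] dominant_norm_less[of m \<delta>] max[of \<delta>] \<delta> m coef_le_refl
      by (fastforce simp: D_def)
    then show ?thesis
      using coef_le_trans \<delta>(2) by blast
  qed
  then show thesis
    using that[of m] m by (auto simp: D_def)
qed

lemma uminus_fiber: "\<gamma> \<in> root_fiber \<Phi> \<Delta> S (- \<beta>) \<longleftrightarrow> - \<gamma> \<in> F"
  using uminus_root[of \<gamma>] uminus_root[of "- \<gamma>"]
  by (auto simp: root_fiber_def coef_uminus)

text \<open>Negation maps the fiber of \<open>- \<beta>\<close> onto \<open>F\<close> and reverses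
  \<open>coef_le\<close>. The locale asks only that \<beta> be a root, so it can be interpreted at
  \<open>- \<beta>\<close>.\<close>

lemma exists_least:
  obtains m where "m \<in> F" "dominant (\<Delta> - S) (- m)" "\<And>\<gamma>. \<gamma> \<in> F \<Longrightarrow> coef_le m \<gamma>"
proof -
  interpret neg: root_fiber_system \<Phi> \<Delta> S "- \<beta>"
    using root Supp_meets uminus_root
    by unfold_locales (auto simp: Supp_def coef_uminus)
  obtain m where m: "m \<in> neg.F" "dominant (\<Delta> - S) m" "\<And>\<gamma>. \<gamma> \<in> neg.F \<Longrightarrow> coef_le \<gamma> m"
    using neg.exists_greatest by blast
  have "coef_le (- m) \<gamma>" if "\<gamma> \<in> F" for \<gamma>
    using m(3)[of "- \<gamma>"] that uminus_fiber[of "- \<gamma>"] by (auto simp: coef_le_def coef_uminus)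
  then show thesis
    using that[of "- m"] m(1,2) uminus_fiber by auto
qed

text \<open>One positive coefficient, shared with \<beta>, determines the sign of all the others.
  This places the fiber in the root poset, where \<open>root_le\<close> and \<open>coef_le\<close>
  agree.\<close>

lemma fiber_positive:
  assumes "\<beta> \<in> positive_roots \<Phi> \<Delta>" "\<gamma> \<in> F"
  shows "\<gamma> \<in> positive_roots \<Phi> \<Delta>"
proof -
  obtain \<alpha> where "\<alpha> \<in> S" "\<alpha> \<in> \<Delta>" "coef \<beta> \<alpha> \<noteq> 0"
    using Supp_meets by (auto simp: Supp_def)
  moreover have "coef \<beta> \<alpha> \<ge> 0"
    using assms(1) \<open>\<alpha> \<in> \<Delta>\<close> by (auto simp: positive_roots_def)
  ultimately have "coef \<gamma> \<alpha> > 0"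
    using assms(2) by (auto simp: root_fiber_def)
  then show ?thesis
    using coef_signs[of \<gamma>] fiber_root[OF assms(2)] \<open>\<alpha> \<in> \<Delta>\<close> by (force simp: positive_roots_def)
qed

lemma root_max_eq:
  assumes "\<beta> \<in> positive_roots \<Phi> \<Delta>" "m \<in> F" "\<And>\<gamma>. \<gamma> \<in> F \<Longrightarrow> coef_le \<gamma> m"
  shows "root_max \<Phi> \<Delta> F = m"
  unfolding root_max_def
  using assms fiber_positive root_le_iff_coef_le
  by (intro the_equality) (auto intro: coef_le_antisym)

lemma root_min_eq:
  assumes "\<beta> \<in> positive_roots \<Phi> \<Delta>" "m \<in> F" "\<And>\<gamma>. \<gamma> \<in> F \<Longrightarrow> coef_le m \<gamma>"
  shows "root_min \<Phi> \<Delta> F = m"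
  unfolding root_min_def
  using assms fiber_positive root_le_iff_coef_le
  by (intro the_equality) (auto intro: coef_le_antisym)

end

section \<open>Dominance and uniqueness of the maximum\<close>

theorem proposition4p6:
  fixes \<Phi> \<Delta> S :: "'a::euclidean_space set" and \<beta> :: 'a
  assumes "irreducible_root_system \<Phi>"
    and "simple_system \<Phi> \<Delta>"
    and "S \<subseteq> \<Delta>"
    and "\<beta> \<in> positive_roots \<Phi> \<Delta>"
    and "Supp \<Delta> \<beta> \<inter> S \<noteq> {}"
  shows "dominant (\<Delta> - S) (root_max \<Phi> \<Delta> (root_fiber \<Phi> \<Delta> S \<beta>)) \<and>
         dominant (\<Delta> - S) (- root_min \<Phi> \<Delta> (root_fiber \<Phi> \<Delta> S \<beta>)) \<and>
         ((\<exists>\<gamma>\<in>root_fiber \<Phi> \<Delta> S \<beta>. long_root \<Phi> \<gamma>) \<longrightarrow>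
            {\<gamma> \<in> root_fiber \<Phi> \<Delta> S \<beta>. long_root \<Phi> \<gamma> \<and> dominant (\<Delta> - S) \<gamma>} =
              {root_max \<Phi> \<Delta> (root_fiber \<Phi> \<Delta> S \<beta>)}) \<and>
         (\<not> (\<exists>\<gamma>\<in>root_fiber \<Phi> \<Delta> S \<beta>. long_root \<Phi> \<gamma>) \<longrightarrow>
            short_root \<Phi> (root_max \<Phi> \<Delta> (root_fiber \<Phi> \<Delta> S \<beta>)) \<and>
            {\<gamma> \<in> root_fiber \<Phi> \<Delta> S \<beta>. dominant (\<Delta> - S) \<gamma>} =
              {root_max \<Phi> \<Delta> (root_fiber \<Phi> \<Delta> S \<beta>)})"
proof -
  interpret irreducible_root_system \<Phi>
    by (rule assms(1))
  interpret root_fiber_system \<Phi> \<Delta> S \<beta>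
    using assms by unfold_locales (auto simp: positive_roots_def)
  obtain m where m: "m \<in> F" "dominant (\<Delta> - S) m" "\<And>\<gamma>. \<gamma> \<in> F \<Longrightarrow> coef_le \<gamma> m"
    using exists_greatest by metis
  have max: "root_max \<Phi> \<Delta> F = m"
    using root_max_eq assms(4) m by blast
  obtain n where n: "n \<in> F" "dominant (\<Delta> - S) (- n)" "\<And>\<gamma>. \<gamma> \<in> F \<Longrightarrow> coef_le n \<gamma>"
    using exists_least by blast
  have min: "root_min \<Phi> \<Delta> F = n"
    using root_min_eq assms(4) n by blast
  have less: "norm \<gamma> < norm m" if "\<gamma> \<in> F" "dominant (\<Delta> - S) \<gamma>" "\<gamma> \<noteq> m" for \<gamma>
    using dominant_norm_less that m by blast
  have long_eq: "\<gamma> = m" if "\<gamma> \<in> F" "dominant (\<Delta> - S) \<gamma>" "long_root \<Phi> \<gamma>" for \<gamma>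
    using less[OF that(1,2)] that(3) fiber_root[OF m(1)] by (force simp: long_root_def)
  \<comment> \<open>The dominant root above a long root has the same norm, so it is long and must be
    \<open>m\<close>.\<close>
  have long: "long_root \<Phi> m" if "\<gamma> \<in> F" "long_root \<Phi> \<gamma>" for \<gamma>
  proof -
    obtain \<delta> where \<delta>: "\<delta> \<in> F" "norm \<delta> = norm \<gamma>" "dominant (\<Delta> - S) \<delta>"
      using exists_dominant_above[OF \<open>\<gamma> \<in> F\<close>] by metis
    then have "long_root \<Phi> \<delta>"
      using that(2) fiber_root by (auto simp: long_root_def)
    then show ?thesis
      using long_eq \<delta> by metis
  qed
  \<comment> \<open>A second dominant root would be shorter than \<open>m\<close>, which is itself
    shorter than some root outside the fiber's lengths: three root lengths in all.\<close>
  have short_eq: "\<gamma> = m" if "\<gamma> \<in> F" "dominant (\<Delta> - S) \<gamma>" "\<not> long_root \<Phi> m" for \<gamma>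
  proof (rule ccontr)
    assume "\<gamma> \<noteq> m"
    then have "norm \<gamma> < norm m"
      using less that by blast
    moreover obtain \<theta> where "\<theta> \<in> \<Phi>" "norm m < norm \<theta>"
      using \<open>\<not> long_root \<Phi> m\<close> fiber_root[OF m(1)] by (auto simp: long_root_def not_le)
    ultimately show False
      using no_three_norms fiber_root that(1) m(1) by blast
  qed
  show ?thesis
    unfolding max min short_root_def
    using m(1,2) n(2) long long_eq short_eq fiber_root by blast
qed

end
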